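(* Let $\{\xi_{n,k}\}$ be a standard triangular array satisfying Feller's negligibility condition and let $\xi$ be a standard normally distributed random variable. Then $$\limsup_{n\to\infty}K\Big(\xi,\sum_{k=1}^n\xi_{n,k}\Big)\le\mathrm{Lin}(\{\xi_{n,k}\}).$$
   Context: A standard triangular array (STA) is a triangular array $\{\xi_{n,k}\}_{n\ge 1,\,1\le k\le n}$ of real square-integrable random variables such that: (a) for each $n$, $\xi_{n,1},\dots,\xi_{n,n}$ are independent; (b) $\mathbb{E}[\xi_{n,k}]=0$ for all $n,k$; (c) $\sum_{k=1}^n\sigma_{n,k}^2=1$ for all $n$, where $\sigma_{n,k}^2=\mathbb{E}[\xi_{n,k}^2]$. It satisfies Feller's negligibility condition if $\max_{1\le k\le n}\sigma_{n,k}^2\to 0$ as $n\to\infty$. The Kolmogorov distance between random variables is $K(\eta,\eta')=\sup_{x\in\mathbb{R}}|\mathbb{P}[\eta\le x]-\mathbb{P}[\eta'\le x]|$. Write $\mathbb{E}[X;A]=\mathbb{E}[X1_A]$. The Lindeberg index is $$\mathrm{Lin}(\{\xi_{n,k}\})=\sup_{\epsilon>0}\limsup_{n\to\infty}\sum_{k=1}^n\mathbb{E}\big[\xi_{n,k}^2;|\xi_{n,k}|\ge\epsilon\big].$$ *)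

theory Defs
  imports "HOL-Probability.Probability"
begin

text \<open>
  Row \<open>n\<close> of a triangular array lives on its own probability space \<open>M n\<close>: only the joint law of
  each row is ever used. The case of a common space is that of a constant \<open>M\<close>.
  Entries \<open>X n k\<close> are meaningful for \<open>1 \<le> k \<le> n\<close> only.
\<close>

definition entry_var ::
  "(nat \<Rightarrow> 'a measure) \<Rightarrow> (nat \<Rightarrow> nat \<Rightarrow> 'a \<Rightarrow> real) \<Rightarrow> nat \<Rightarrow> nat \<Rightarrow> real" where
  "entry_var M X n k = (LINT w|M n. (X n k w)\<^sup>2)"

definition standard_triangular_array ::
  "(nat \<Rightarrow> 'a measure) \<Rightarrow> (nat \<Rightarrow> nat \<Rightarrow> 'a \<Rightarrow> real) \<Rightarrow> bool" where
  "standard_triangular_array M X \<longleftrightarrow>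
     (\<forall>n\<ge>1.
        prob_space (M n) \<and>
        (\<forall>k\<in>{1..n}. X n k \<in> borel_measurable (M n) \<and> integrable (M n) (\<lambda>w. (X n k w)\<^sup>2)) \<and>
        prob_space.indep_vars (M n) (\<lambda>_. borel) (X n) {1..n} \<and>
        (\<forall>k\<in>{1..n}. (LINT w|M n. X n k w) = 0) \<and>
        (\<Sum>k=1..n. entry_var M X n k) = 1)"

definition feller_negligible ::
  "(nat \<Rightarrow> 'a measure) \<Rightarrow> (nat \<Rightarrow> nat \<Rightarrow> 'a \<Rightarrow> real) \<Rightarrow> bool" where
  "feller_negligible M X \<longleftrightarrow> (\<lambda>n. Max (entry_var M X n ` {1..n})) \<longlonglongrightarrow> 0"

text \<open>
  The two random variables may live on different probability spaces. The supremum is taken in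
  the reals, where the set of values is bounded by 1.
\<close>

definition kolmogorov_dist ::
  "'a measure \<Rightarrow> ('a \<Rightarrow> real) \<Rightarrow> 'b measure \<Rightarrow> ('b \<Rightarrow> real) \<Rightarrow> real" where
  "kolmogorov_dist M X N Y =
     (SUP x. \<bar>measure M {w \<in> space M. X w \<le> x} - measure N {w \<in> space N. Y w \<le> x}\<bar>)"

lemma kolmogorov_dist_bdd_above:
  assumes "prob_space M" "prob_space N"
  shows "bdd_above (range (\<lambda>x::real.
    \<bar>measure M {w \<in> space M. X w \<le> x} - measure N {w \<in> space N. Y w \<le> x}\<bar>))"
proof (rule bdd_aboveI2)
  fix x
  show "\<bar>measure M {w \<in> space M. X w \<le> x} - measure N {w \<in> space N. Y w \<le> x}\<bar> \<le> 1"
    using prob_space.prob_le_1[OF assms(1), of "{w \<in> space M. X w \<le> x}"]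
      prob_space.prob_le_1[OF assms(2), of "{w \<in> space N. Y w \<le> x}"]
      measure_nonneg[of M "{w \<in> space M. X w \<le> x}"]
      measure_nonneg[of N "{w \<in> space N. Y w \<le> x}"]
    by linarith
qed

definition lindeberg_index ::
  "(nat \<Rightarrow> 'a measure) \<Rightarrow> (nat \<Rightarrow> nat \<Rightarrow> 'a \<Rightarrow> real) \<Rightarrow> ereal" where
  "lindeberg_index M X =
     (SUP \<epsilon>\<in>{0<..}. limsup (\<lambda>n. ereal (\<Sum>k=1..n.
        LINT w:{w \<in> space (M n). \<bar>X n k w\<bar> \<ge> \<epsilon>}|M n. (X n k w)\<^sup>2)))"

end

theory Submission
  imports Defs
begin

text \<open>
  The proof is Stein's method, and the constant \<open>1\<close> in front of the Lindeberg index comes from one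
  exact computation. For a real \<open>s\<close> let \<open>f\<close> solve the Stein equation
  \<open>f' x - x * f x = indicator {..s} x - Phi s\<close>, where \<open>Phi\<close> is the standard normal distribution
  function. Evaluating at the sum \<open>W\<close> of a row gives \<open>P (W \<le> s) - Phi s = E (f' W - W * f W)\<close>,
  so it suffices to bound the right-hand side.

  Write \<open>W = V + Y\<close> with \<open>Y\<close> one entry of the row, independent of \<open>V\<close>. Since \<open>E Y = 0\<close>,
  \<open>E (Y * f W) = E (Y\<^sup>2) * E (f' V) + E (Y * R)\<close>, where
  \<open>R = f (V + Y) - f V - Y * f' V\<close> is the Taylor remainder. It has two bounds. If \<open>f'\<close> oscillates
  by at most \<open>1\<close>, then \<open>\<bar>R\<bar> \<le> \<bar>Y\<bar>\<close>, which is used where \<open>\<bar>Y\<bar> \<ge> \<epsilon>\<close>: summed over the row this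
  contributes at most the Lindeberg sum. If \<open>f'\<close> has a local Lipschitz bound, then \<open>R\<close> is quadratic in \<open>Y\<close>,
  and on \<open>\<bar>Y\<bar> < \<epsilon>\<close> the contribution is \<open>O(\<epsilon>)\<close> because the variances sum to \<open>1\<close>. The Lipschitz
  bound also replaces \<open>E (f' V)\<close> by \<open>E (f' W)\<close> at a cost of the order of the standard deviation
  of \<open>Y\<close>, which is negligible by Feller's condition (\<open>stein_summand_bound\<close>,
  \<open>stein_identity_bound\<close>).

  The oscillation of \<open>f'\<close> is at most \<open>1\<close> because \<open>f'\<close> increases from \<open>0\<close> on \<open>{..s}\<close>, jumps down
  by \<open>1\<close> at \<open>s\<close>, and increases back to \<open>0\<close> afterwards (\<open>stein'_osc\<close>). The jump, however,
  rules out a Lipschitz bound. Therefore \<open>f\<close> is averaged over many thresholds \<open>s\<close> spread evenly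
  over an interval of length \<open>\<delta>\<close>. Averaging keeps the oscillation bound and leaves jumps of size
  \<open>1 / m\<close> only, where the number \<open>m\<close> of thresholds can be sent to infinity
  (\<open>smooth_stein'_lipschitz\<close>). Since distribution functions are monotone and \<open>Phi\<close> is
  Lipschitz, undoing the average costs at most \<open>\<delta>\<close>. The outcome is a bound for a single row, uniform in
  the threshold (\<open>kolmogorov_stein_bound\<close>), into which \<open>\<epsilon> = \<delta>\<^sup>2\<close> and then \<open>\<delta> \<rightarrow> 0\<close> are inserted.
\<close>

section \<open>The standard normal distribution function\<close>

abbreviation phi :: "real \<Rightarrow> real" where "phi \<equiv> std_normal_density"
definition Phi :: "real \<Rightarrow> real" where "Phi x = cdf std_normal_distribution x"

lemma phi_deriv [derivative_intros]: "(phi has_real_derivative - x * phi x) (at x)"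
  unfolding std_normal_density_def by (auto intro!: derivative_eq_intros simp: field_simps)

lemma phi_pos [simp]: "0 < phi x" by (rule normal_density_pos) simp

lemma phi_neq_0 [simp]: "phi x \<noteq> 0" using phi_pos[of x] by linarith

lemma phi_le_1: "phi x \<le> 1"
proof -
  have "sqrt (2 * pi) \<ge> 1" using pi_gt3 by (simp add: real_le_rsqrt)
  hence "1 / sqrt (2 * pi) \<le> 1" by simp
  moreover have "exp (- x\<^sup>2 / 2) \<le> 1" by simp
  ultimately show ?thesis unfolding std_normal_density_def
    using mult_mono[of "1 / sqrt (2 * pi)" 1 "exp (- x\<^sup>2 / 2)" 1] by simp
qed

lemma phi_minus: "phi (- x) = phi x" by (simp add: std_normal_density_def)

interpretation std: real_distribution std_normal_distribution
  by (rule real_dist_normal_dist)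

lemma Phi_diff:
  assumes "a \<le> y" shows "Phi y - Phi a = integral {a..y} phi"
proof (cases "a = y")
  case False
  hence "a < y" using assms by simp
  have int: "integrable lborel phi" by (simp add: integrable_normal_density)
  have "Phi y - Phi a = measure std_normal_distribution {a<..y}"
    unfolding Phi_def using std.cdf_diff_eq[OF \<open>a < y\<close>] .
  also have "\<dots> = (\<integral>x. indicator {a<..y} x \<partial>std_normal_distribution)" by simp
  also have "\<dots> = (\<integral>x. phi x * indicator {a<..y} x \<partial>lborel)"
    by (subst integral_real_density) auto
  also have "\<dots> = (LINT x:{a<..y}|lborel. phi x)"
    unfolding set_lebesgue_integral_def by (simp add: mult.commute)
  also have "\<dots> = integral {a<..y} phi"
    by (rule set_borel_integral_eq_integral)
       (use int in \<open>auto simp: set_integrable_def intro!: integrable_mult_indicator[of _ lborel phi, simplified]\<close>)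
  also have "\<dots> = integral {a..y} phi"
    by (rule integral_spike_set) (auto intro: negligible_subset[of "{a}"])
  finally show ?thesis .
qed simp

lemma Phi_deriv [derivative_intros]: "(Phi has_real_derivative phi x) (at x)"
proof -
  have cont: "continuous_on {x-1..x+1} phi"
    by (rule DERIV_continuous_on) (rule has_field_derivative_at_within[OF phi_deriv])
  have "((\<lambda>u. integral {x-1..u} phi) has_real_derivative phi x) (at x within {x-1..x+1})"
    by (rule integral_has_real_derivative[OF cont]) auto
  hence "((\<lambda>u. integral {x-1..u} phi) has_real_derivative phi x) (at x)"
    using at_within_Icc_at[of "x - 1" x "x + 1"] by simp
  from DERIV_add[OF DERIV_const[of "Phi (x - 1)"] this]
  have 1: "((\<lambda>u. Phi (x-1) + integral {x-1..u} phi) has_real_derivative phi x) (at x)" by simp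
  have "\<forall>\<^sub>F u in nhds x. Phi (x-1) + integral {x-1..u} phi = Phi u"
    using eventually_nhds_in_open[of "{x-1<..}" x]
    by (auto elim!: eventually_mono simp: Phi_diff[symmetric])
  from DERIV_cong_ev[OF refl this refl] 1 show ?thesis by blast
qed

lemma Phi_nonneg: "0 \<le> Phi x" and Phi_le_1: "Phi x \<le> 1"
  and Phi_mono: "x \<le> y \<Longrightarrow> Phi x \<le> Phi y" and Phi_at_bot: "(Phi \<longlongrightarrow> 0) at_bot"
  unfolding Phi_def[abs_def]
  using std.cdf_nonneg std.cdf_bounded_prob std.cdf_nondecreasing std.cdf_lim_at_bot by auto

lemma Phi_minus: "Phi (- x) = 1 - Phi x"
proof -
  have "((\<lambda>x. Phi x + Phi (- x)) has_real_derivative 0) (at x)" for x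
  proof -
    have "((\<lambda>x. Phi (- x)) has_real_derivative phi (- x) * (- 1)) (at x)"
      by (rule DERIV_chain2[OF Phi_deriv]) (auto intro!: derivative_eq_intros)
    from DERIV_add[OF Phi_deriv this] show ?thesis by (simp add: phi_minus)
  qed
  hence const: "Phi u + Phi (- u) = Phi x + Phi (- x)" for u
    using DERIV_isconst_all[of "\<lambda>x. Phi x + Phi (- x)"] by blast
  have "((\<lambda>u. Phi u + Phi (- u)) \<longlongrightarrow> 1 + 0) at_top"
    unfolding Phi_def[abs_def]
    by (intro tendsto_add std.cdf_lim_at_top_prob
        filterlim_compose[OF std.cdf_lim_at_bot filterlim_uminus_at_bot_at_top])
  moreover have "(\<lambda>u. Phi u + Phi (- u)) = (\<lambda>u. Phi x + Phi (- x))"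
    by (rule ext) (rule const)
  ultimately have "((\<lambda>u::real. Phi x + Phi (- x)) \<longlongrightarrow> 1) at_top"
    by simp
  hence "Phi x + Phi (- x) = 1" by (simp add: tendsto_const_iff)
  thus ?thesis by simp
qed

text \<open>
  The inequalities for \<open>Phi\<close> below come from differentiation: a function that vanishes at
  minus infinity and has nonnegative derivative is nonnegative.
\<close>

lemma nonneg_from_bot:
  fixes G G' :: "real \<Rightarrow> real"
  assumes d: "\<And>x. x \<le> b \<Longrightarrow> (G has_real_derivative G' x) (at x)"
    and p: "\<And>x. x \<le> b \<Longrightarrow> G' x \<ge> 0" and l: "(G \<longlongrightarrow> 0) at_bot"
  shows "G b \<ge> 0"
proof (rule tendsto_upperbound[OF l])
  show "\<forall>\<^sub>F x in at_bot. G x \<le> G b"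
    using eventually_le_at_bot[of b]
  proof eventually_elim
    case (elim x)
    show ?case by (rule DERIV_nonneg_imp_nondecreasing[OF elim]) (use d p in blast)
  qed
qed simp

lemma phi_at_bot: "((\<lambda>x. x ^ k * phi x) \<longlongrightarrow> 0) at_bot" if "k \<le> 2"
proof -
  have "k = 0 \<or> k = 1 \<or> k = 2" using that by auto
  thus ?thesis unfolding std_normal_density_def by (elim disjE; simp only:; real_asymp)
qed

text \<open>
  A crude tail bound; with \<open>phi_at_bot\<close> it makes \<open>x ^ k * Phi x\<close> vanish at minus infinity
  for \<open>k \<le> 2\<close>.
\<close>

lemma Phi_le_phi: assumes "x \<le> - 1" shows "Phi x \<le> phi x"
proof -
  have "((\<lambda>x. phi x - Phi x) \<longlongrightarrow> 0 - 0) at_bot"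
    by (intro tendsto_diff Phi_at_bot phi_at_bot[of 0, simplified])
  hence l: "((\<lambda>x. phi x - Phi x) \<longlongrightarrow> 0) at_bot" by simp
  have "0 \<le> phi x - Phi x"
  proof (rule nonneg_from_bot[OF _ _ l])
    fix y assume "y \<le> x"
    show "((\<lambda>x. phi x - Phi x) has_real_derivative (- 1 - y) * phi y) (at y)"
      by (auto intro!: derivative_eq_intros simp: algebra_simps)
    show "(- 1 - y) * phi y \<ge> 0" using \<open>y \<le> x\<close> assms by (intro mult_nonneg_nonneg) auto
  qed
  thus ?thesis by simp
qed

lemma pow_Phi_at_bot: "((\<lambda>x. x ^ k * Phi x) \<longlongrightarrow> 0) at_bot" if "k \<le> 2"
proof (rule Lim_null_comparison[OF _ tendsto_rabs_zero[OF phi_at_bot[OF that]]])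
  show "\<forall>\<^sub>F x in at_bot. norm (x ^ k * Phi x) \<le> \<bar>x ^ k * phi x\<bar>"
    using eventually_le_at_bot[of "-1"]
    by eventually_elim (auto simp: abs_mult Phi_nonneg intro!: mult_left_mono Phi_le_phi)
qed

text \<open>
  The left-hand side is the expectation of the positive part of \<open>x - \<xi>\<close> for a standard normal
  \<open>\<xi>\<close>.
\<close>

lemma first_moment_nonneg: "phi x + x * Phi x \<ge> 0"
proof (rule nonneg_from_bot[where G = "\<lambda>x. phi x + x * Phi x"])
  fix y show "((\<lambda>x. phi x + x * Phi x) has_real_derivative Phi y) (at y)"
    by (auto intro!: derivative_eq_intros simp: algebra_simps)
  have "((\<lambda>x. phi x + x * Phi x) \<longlongrightarrow> 0 + 0) at_bot"
    by (intro tendsto_add phi_at_bot[of 0, simplified] pow_Phi_at_bot[of 1, simplified])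
  thus "((\<lambda>x. phi x + x * Phi x) \<longlongrightarrow> 0) at_bot" by simp
qed (rule Phi_nonneg)

text \<open>
  The left-hand side is the expectation of the squared positive part of \<open>x - \<xi>\<close>; accordingly
  its derivative is twice the left-hand side of \<open>first_moment_nonneg\<close>.
\<close>

lemma second_moment_nonneg: "(1 + x\<^sup>2) * Phi x + x * phi x \<ge> 0"
proof (rule nonneg_from_bot[where G = "\<lambda>x. (1 + x\<^sup>2) * Phi x + x * phi x"])
  fix y show "((\<lambda>x. (1 + x\<^sup>2) * Phi x + x * phi x) has_real_derivative 2 * (phi y + y * Phi y)) (at y)"
    by (auto intro!: derivative_eq_intros simp: algebra_simps power2_eq_square)
  have "((\<lambda>x. (Phi x + x^2 * Phi x) + x^1 * phi x) \<longlongrightarrow> (0 + 0) + 0) at_bot"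
    by (intro tendsto_add Phi_at_bot phi_at_bot pow_Phi_at_bot) auto
  thus "((\<lambda>x. (1 + x\<^sup>2) * Phi x + x * phi x) \<longlongrightarrow> 0) at_bot" by (simp add: algebra_simps)
qed (simp only: mult_nonneg_nonneg first_moment_nonneg zero_le_numeral)

section \<open>The Stein equation for half-lines\<close>

text \<open>
  The Mills ratio of the lower tail. It solves \<open>y' - x * y = 1\<close>. On either side of the
  threshold the right-hand side of the Stein equation for a half-line is constant, so the solution
  there is a multiple of this function or of its reflection.
\<close>

definition mills :: "real \<Rightarrow> real" where "mills x = Phi x / phi x"
definition mills' :: "real \<Rightarrow> real" where "mills' x = 1 + x * mills x"

lemma mills_deriv: "(mills has_real_derivative mills' x) (at x)"
  unfolding mills_def[abs_def] mills'_def
  by (rule derivative_eq_intros refl | simp add: field_simps power2_eq_square)+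

lemma mills_nonneg: "0 \<le> mills x" by (simp add: mills_def Phi_nonneg)

lemma mills'_nonneg: "0 \<le> mills' x"
proof -
  have "mills' x = (phi x + x * Phi x) / phi x" by (simp add: mills'_def mills_def field_simps)
  thus ?thesis using first_moment_nonneg[of x] by simp
qed

lemma mills_mono: "x \<le> y \<Longrightarrow> mills x \<le> mills y"
  by (rule DERIV_nonneg_imp_nondecreasing) (use mills_deriv mills'_nonneg in blast)+

text \<open>
  Convexity of the Mills ratio: its second derivative is the quantity of
  \<open>second_moment_nonneg\<close> divided by the density.
\<close>

lemma mills'_mono: assumes "x \<le> y" shows "mills' x \<le> mills' y"
proof (rule DERIV_nonneg_imp_nondecreasing[OF assms])
  fix z
  have "((\<lambda>x. 1 + x * mills x) has_real_derivative mills z + z * mills' z) (at z)"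
    by (auto intro!: derivative_eq_intros mills_deriv)
  hence "(mills' has_real_derivative mills z + z * mills' z) (at z)"
    by (simp add: mills'_def[abs_def])
  moreover have "mills z + z * mills' z = ((1 + z\<^sup>2) * Phi z + z * phi z) / phi z"
    by (simp add: mills'_def mills_def field_simps power2_eq_square)
  hence "mills z + z * mills' z \<ge> 0" using second_moment_nonneg[of z] by simp
  ultimately show "\<exists>y. (mills' has_real_derivative y) (at z) \<and> 0 \<le> y" by blast
qed

text \<open>
  Up to sign, the two summands are the one-sided limits of the derivative of the Stein
  solution at its threshold \<open>s\<close>. That they add up to exactly \<open>1\<close> is the source of
  the constant \<open>1\<close> in the theorem.
\<close>

lemma mills'_split: "mills' s * Phi (- s) + mills' (- s) * Phi s = 1"
proof -
  have "mills' s * Phi (- s) + mills' (- s) * Phi s = Phi s + Phi (- s)"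
    by (simp add: mills'_def mills_def phi_minus field_simps)
  thus ?thesis by (simp add: Phi_minus)
qed

text \<open>
  The bounded solution of the Stein equation for \<open>{..s}\<close>. At the threshold itself, where it is not
  differentiable, \<open>stein'\<close> takes the left derivative, so that \<open>stein_equation\<close> holds everywhere.
\<close>

definition stein :: "real \<Rightarrow> real \<Rightarrow> real" where
  "stein s x = (if x \<le> s then mills x * Phi (- s) else mills (- x) * Phi s)"

definition stein' :: "real \<Rightarrow> real \<Rightarrow> real" where
  "stein' s x = (if x \<le> s then mills' x * Phi (- s) else - mills' (- x) * Phi s)"

lemma stein_equation: "stein' s x - x * stein s x = indicator {..s} x - Phi s"
  by (auto simp: stein_def stein'_def mills'_def Phi_minus algebra_simps)

lemma stein_nonneg: "0 \<le> stein s x"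
  by (auto simp: stein_def mills_nonneg Phi_nonneg)

text \<open>
  The left-hand side is even in \<open>x\<close> because the density is, so it may be bounded on the negative
  half-line, where the Mills ratio is at most its value at \<open>0\<close>.
\<close>

lemma mills_Phi_minus_le: "mills x * Phi (- x) \<le> mills 0"
proof (cases "x \<le> 0")
  case True
  thus ?thesis using mult_mono[OF mills_mono[OF True] Phi_le_1[of "-x"]]
    by (simp add: mills_nonneg Phi_nonneg)
next
  case False
  have "mills x * Phi (- x) = mills (- x) * Phi x" by (simp add: mills_def phi_minus)
  also have "\<dots> \<le> mills 0"
    using False mult_mono[OF mills_mono[of "-x" 0] Phi_le_1[of x]] by (simp add: mills_nonneg Phi_nonneg)
  finally show ?thesis .
qed

lemma stein_le: "stein s x \<le> mills 0"
proof (cases "x \<le> s")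
  case True
  thus ?thesis using mult_left_mono[OF Phi_mono[of "-s" "-x"] mills_nonneg[of x]] mills_Phi_minus_le[of x]
    by (simp add: stein_def)
next
  case False
  thus ?thesis using mult_left_mono[OF Phi_mono[of s x] mills_nonneg[of "-x"]] mills_Phi_minus_le[of "-x"]
    by (simp add: stein_def)
qed

text \<open>
  By \<open>mills'_mono\<close> the derivative is extremal at the two sides of the threshold, and the
  extreme values differ by \<open>1\<close> according to \<open>mills'_split\<close>.
\<close>

lemma stein'_osc: "\<bar>stein' s x - stein' s y\<bar> \<le> 1"
proof -
  have r: "stein' s u \<in> {- (mills' (- s) * Phi s)..mills' s * Phi (- s)}" for u
    unfolding stein'_def
    using mult_right_mono[OF mills'_mono[of u s] Phi_nonneg[of "-s"]]
      mult_right_mono[OF mills'_mono[of "-u" "-s"] Phi_nonneg[of s]]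
      mult_nonneg_nonneg[OF mills'_nonneg Phi_nonneg, of u "-s"]
      mult_nonneg_nonneg[OF mills'_nonneg Phi_nonneg, of "-u" s]
      mult_nonneg_nonneg[OF mills'_nonneg Phi_nonneg, of "s" "-s"]
      mult_nonneg_nonneg[OF mills'_nonneg Phi_nonneg, of "-s" s]
    by auto
  show ?thesis using r[of x] r[of y] mills'_split[of s] by auto
qed

text \<open>
  The derivative takes a nonnegative and a nonpositive value, so \<open>stein'_osc\<close> bounds it.
\<close>

lemma stein'_bound: "\<bar>stein' s x\<bar> \<le> 1"
proof -
  have "stein' s s \<ge> 0" "stein' s (s + 1) \<le> 0"
    by (simp_all add: stein'_def mills'_nonneg Phi_nonneg)
  thus ?thesis using stein'_osc[of s x s] stein'_osc[of s x "s + 1"] by linarith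
qed

lemma stein_cont: "continuous_on UNIV (stein s)"
proof -
  have m: "continuous_on S mills" for S
    by (rule DERIV_continuous_on[of _ _ mills']) (auto intro: has_field_derivative_at_within mills_deriv)
  have "continuous_on ({..s} \<union> {s..}) (\<lambda>x. if x \<le> s then mills x * Phi (- s) else mills (- x) * Phi s)"
  proof (rule continuous_on_cases)
    show "continuous_on {..s} (\<lambda>x. mills x * Phi (- s))" by (intro continuous_intros m)
    show "continuous_on {s..} (\<lambda>x. mills (- x) * Phi s)"
      by (intro continuous_intros continuous_on_compose2[OF m[of UNIV]]) auto
  qed (auto simp: mills_def phi_minus)
  moreover have "{..s} \<union> {s..} = UNIV" by auto
  ultimately show ?thesis by (simp add: stein_def[abs_def])
qed

lemma stein_deriv: assumes "x \<noteq> s" shows "(stein s has_real_derivative stein' s x) (at x)"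
proof (cases "x < s")
  case True
  have "((\<lambda>x. mills x * Phi (- s)) has_real_derivative mills' x * Phi (- s)) (at x)"
    by (auto intro!: derivative_eq_intros mills_deriv)
  hence "(stein s has_real_derivative mills' x * Phi (- s)) (at x)"
    by (rule has_field_derivative_transform_within_open[where S = "{..<s}"])
       (use True in \<open>auto simp: stein_def\<close>)
  thus ?thesis using True by (simp add: stein'_def)
next
  case False
  have "((\<lambda>x. mills (- x)) has_real_derivative mills' (- x) * (- 1)) (at x)"
    by (rule DERIV_chain2[OF mills_deriv]) (auto intro!: derivative_eq_intros)
  hence "((\<lambda>x. mills (- x) * Phi s) has_real_derivative - mills' (- x) * Phi s) (at x)"
    by (auto intro!: derivative_eq_intros)
  hence "(stein s has_real_derivative - mills' (- x) * Phi s) (at x)"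
    by (rule has_field_derivative_transform_within_open[where S = "{s<..}"])
       (use False assms in \<open>auto simp: stein_def\<close>)
  thus ?thesis using False assms by (simp add: stein'_def)
qed

section \<open>Averaged Stein solutions\<close>

text \<open>
  A mean value inequality that tolerates finitely many points without derivative; the exceptional
  points are the thresholds of an averaged Stein solution.
\<close>

lemma derivative_bound_finite_exceptions:
  fixes F D :: "real \<Rightarrow> real"
  assumes S: "finite S" and cont: "continuous_on UNIV F"
    and d: "\<And>u. u \<notin> S \<Longrightarrow> (F has_real_derivative D u) (at u)"
    and b: "\<And>u. u \<in> closed_segment x y \<Longrightarrow> \<bar>D u - L\<bar> \<le> B"
  shows "\<bar>F y - F x - (y - x) * L\<bar> \<le> \<bar>y - x\<bar> * B"
proof -
  have B: "0 \<le> B" using b[of x] by auto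
  have main: "\<bar>F q - F p - (q - p) * L\<bar> \<le> (q - p) * B"
    if pq: "p \<le> q" "{p..q} \<subseteq> closed_segment x y" for p q
  proof -
    have "((\<lambda>u. D u - L) has_integral (F q - L * q) - (F p - L * p)) {p..q}"
    proof (rule fundamental_theorem_of_calculus_strong[OF S pq(1)])
      show "((\<lambda>u. F u - L * u) has_vector_derivative D u - L) (at u)" if "u \<in> {p..q} - S" for u
        using d[of u] that
        by (auto intro!: derivative_eq_intros simp: has_real_derivative_iff_has_vector_derivative[symmetric])
      show "continuous_on {p..q} (\<lambda>u. F u - L * u)"
        by (intro continuous_intros continuous_on_subset[OF cont]) auto
    qed
    from has_integral_bound[OF B this[unfolded box_real(2)[symmetric]]] b pq
    have "norm ((F q - L * q) - (F p - L * p)) \<le> B * (q - p)"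
      by (auto simp: subset_iff)
    thus ?thesis by (simp add: algebra_simps)
  qed
  show ?thesis
  proof (cases "x \<le> y")
    case True
    thus ?thesis using main[of x y] by (simp add: closed_segment_eq_real_ivl)
  next
    case False
    have "F y - F x - (y - x) * L = - (F x - F y - (x - y) * L)" by (simp add: algebra_simps)
    thus ?thesis using main[of y x] False by (simp add: closed_segment_eq_real_ivl)
  qed
qed

text \<open>
  This count bounds the number of thresholds between two points, hence the variation of an average
  of half-line indicators.
\<close>

lemma card_progression_le:
  fixes x y z \<eta> :: real
  assumes "x \<le> y" "0 < \<eta>"
  shows "real (card {j. j < m \<and> x \<le> z + real j * \<eta> \<and> z + real j * \<eta> < y}) \<le> (y - x) / \<eta> + 1"
proof -
  let ?J = "{j. j < m \<and> x \<le> z + real j * \<eta> \<and> z + real j * \<eta> < y}"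
  have sub: "int ` ?J \<subseteq> {\<lceil>(x - z) / \<eta>\<rceil>..<\<lceil>(y - z) / \<eta>\<rceil>}"
    using assms by (auto simp: ceiling_le_iff less_ceiling_iff field_simps)
  have "card ?J = card (int ` ?J)" by (simp add: card_image)
  also have "\<dots> \<le> card {\<lceil>(x - z) / \<eta>\<rceil>..<\<lceil>(y - z) / \<eta>\<rceil>}" by (rule card_mono[OF _ sub]) simp
  finally have "card ?J \<le> nat (\<lceil>(y - z) / \<eta>\<rceil> - \<lceil>(x - z) / \<eta>\<rceil>)" by simp
  moreover have "(x - z) / \<eta> \<le> (y - z) / \<eta>" using assms by (simp add: divide_right_mono)
  hence "\<lceil>(x - z) / \<eta>\<rceil> \<le> \<lceil>(y - z) / \<eta>\<rceil>" by (rule ceiling_mono)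
  ultimately have "real (card ?J) \<le> real_of_int (\<lceil>(y - z) / \<eta>\<rceil> - \<lceil>(x - z) / \<eta>\<rceil>)" by linarith
  also have "\<dots> \<le> ((y - z) / \<eta> + 1) - (x - z) / \<eta>" by linarith
  also have "\<dots> = (y - x) / \<eta> + 1" by (simp add: diff_divide_distrib)
  finally show ?thesis .
qed

definition avg :: "nat \<Rightarrow> (nat \<Rightarrow> real) \<Rightarrow> real" where
  "avg m a = (\<Sum>j<m. a j) / real m"

lemma avg_diff: "avg m a - avg m b = avg m (\<lambda>j. a j - b j)"
  by (simp add: avg_def sum_subtractf diff_divide_distrib)

lemma avg_mult: "c * avg m a = avg m (\<lambda>j. c * a j)"
  by (simp add: avg_def sum_distrib_left)

lemma abs_avg_le: assumes "\<And>j. \<bar>a j\<bar> \<le> B" "0 < m" shows "\<bar>avg m a\<bar> \<le> B"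
proof -
  have "\<bar>\<Sum>j<m. a j\<bar> \<le> (\<Sum>j<m. B)" by (rule order_trans[OF sum_abs sum_mono]) (rule assms(1))
  thus ?thesis using assms(2) by (simp add: avg_def field_simps)
qed

lemma avg_const: "0 < m \<Longrightarrow> avg m (\<lambda>_. c) = c" by (simp add: avg_def)

lemma avg_mono: "(\<And>j. j < m \<Longrightarrow> a j \<le> b j) \<Longrightarrow> avg m a \<le> avg m b"
  unfolding avg_def by (intro divide_right_mono sum_mono) auto

text \<open>
  The average is a staircase descending from \<open>1\<close> to \<open>0\<close> over an interval of length \<open>m * \<eta>\<close> in
  steps of height \<open>1 / m\<close>: it is Lipschitz up to one step.
\<close>

lemma avg_indicator_lipschitz:
  fixes z \<eta> x y :: real
  assumes "0 < \<eta>" "0 < m"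
  shows "\<bar>avg m (\<lambda>j. indicator {..z + real j * \<eta>} x) - avg m (\<lambda>j. indicator {..z + real j * \<eta>} y)\<bar>
     \<le> \<bar>x - y\<bar> / (real m * \<eta>) + 1 / real m"
proof -
  define A where "A x = avg m (\<lambda>j. indicator {..z + real j * \<eta>} x)" for x
  have main: "\<bar>A x - A y\<bar> \<le> \<bar>x - y\<bar> / (real m * \<eta>) + 1 / real m" if "x \<le> y" for x y
  proof -
    let ?J = "{j. j < m \<and> x \<le> z + real j * \<eta> \<and> z + real j * \<eta> < y}"
    have "A x - A y = avg m (\<lambda>j. indicator ?J j)"
      unfolding A_def avg_diff unfolding avg_def
      using that by (intro arg_cong2[where f = "(/)"] sum.cong) (auto simp: indicator_def)
    also have "\<dots> = real (card ({..<m} \<inter> ?J)) / real m"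
      by (simp add: avg_def indicator_def of_bool_def sum.If_cases del: Collect_conj_eq mem_Collect_eq)
    also have "{..<m} \<inter> ?J = ?J" by auto
    finally have eq: "A x - A y = real (card ?J) / real m" .
    hence "\<bar>A x - A y\<bar> = real (card ?J) / real m" by simp
    also have "\<dots> \<le> ((y - x) / \<eta> + 1) / real m"
      by (rule divide_right_mono[OF card_progression_le[OF that assms(1)]]) simp
    also have "\<dots> = \<bar>x - y\<bar> / (real m * \<eta>) + 1 / real m"
      using that assms by (simp add: field_simps)
    finally show ?thesis .
  qed
  show ?thesis
    using main[of x y] main[of y x] by (cases "x \<le> y") (auto simp: A_def abs_minus_commute)
qed

definition smooth_stein :: "real \<Rightarrow> real \<Rightarrow> nat \<Rightarrow> real \<Rightarrow> real" where
  "smooth_stein z \<eta> m x = avg m (\<lambda>j. stein (z + real j * \<eta>) x)"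

definition smooth_stein' :: "real \<Rightarrow> real \<Rightarrow> nat \<Rightarrow> real \<Rightarrow> real" where
  "smooth_stein' z \<eta> m x = avg m (\<lambda>j. stein' (z + real j * \<eta>) x)"

lemma smooth_stein_equation:
  "smooth_stein' z \<eta> m x - x * smooth_stein z \<eta> m x
     = avg m (\<lambda>j. indicator {..z + real j * \<eta>} x) - avg m (\<lambda>j. Phi (z + real j * \<eta>))"
  unfolding smooth_stein_def smooth_stein'_def avg_mult avg_diff stein_equation ..

lemma smooth_stein_cont: "continuous_on UNIV (smooth_stein z \<eta> m)"
proof -
  have "continuous_on UNIV (\<lambda>x. (\<Sum>j<m. stein (z + real j * \<eta>) x) * (1 / real m))"
    by (intro continuous_on_mult_right continuous_on_sum stein_cont)
  thus ?thesis by (simp add: smooth_stein_def[abs_def] avg_def)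
qed

lemma smooth_stein_deriv:
  assumes "x \<notin> (\<lambda>j. z + real j * \<eta>) ` {..<m}"
  shows "(smooth_stein z \<eta> m has_real_derivative smooth_stein' z \<eta> m x) (at x)"
  unfolding smooth_stein_def[abs_def] smooth_stein'_def avg_def
  by (intro DERIV_cdivide DERIV_sum stein_deriv) (use assms in auto)

lemma smooth_stein_measurable: "smooth_stein z \<eta> m \<in> borel_measurable borel"
  by (rule borel_measurable_continuous_onI[OF smooth_stein_cont])

lemma smooth_stein'_measurable: "smooth_stein' z \<eta> m \<in> borel_measurable borel"
proof -
  have "smooth_stein' z \<eta> m = (\<lambda>x. x * smooth_stein z \<eta> m x
     + (avg m (\<lambda>j. indicator {..z + real j * \<eta>} x) - avg m (\<lambda>j. Phi (z + real j * \<eta>))))"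
    by (simp add: smooth_stein_equation[symmetric])
  also have "\<dots> \<in> borel_measurable borel"
    using smooth_stein_measurable[measurable] unfolding avg_def by measurable
  finally show ?thesis .
qed

context
  fixes z \<eta> :: real and m :: nat
  assumes eta: "0 < \<eta>" and m: "0 < m"
begin

lemma smooth_stein_bound: "\<bar>smooth_stein z \<eta> m x\<bar> \<le> mills 0"
  unfolding smooth_stein_def by (rule abs_avg_le[OF _ m]) (use stein_nonneg stein_le in auto)

lemma smooth_stein'_bound: "\<bar>smooth_stein' z \<eta> m x\<bar> \<le> 1"
  unfolding smooth_stein'_def by (rule abs_avg_le[OF stein'_bound m])

lemma smooth_stein'_osc: "\<bar>smooth_stein' z \<eta> m x - smooth_stein' z \<eta> m y\<bar> \<le> 1"
  unfolding smooth_stein'_def avg_diff by (rule abs_avg_le[OF stein'_osc m])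

lemma smooth_stein_increment:
  assumes "\<And>u. u \<in> closed_segment x y \<Longrightarrow> \<bar>smooth_stein' z \<eta> m u - L\<bar> \<le> B"
  shows "\<bar>smooth_stein z \<eta> m y - smooth_stein z \<eta> m x - (y - x) * L\<bar> \<le> \<bar>y - x\<bar> * B"
  by (rule derivative_bound_finite_exceptions[OF _ smooth_stein_cont smooth_stein_deriv assms]) auto

lemma smooth_stein_lipschitz: "\<bar>smooth_stein z \<eta> m y - smooth_stein z \<eta> m x\<bar> \<le> \<bar>y - x\<bar>"
  using smooth_stein_increment[of x y 0 1] smooth_stein'_bound by simp

text \<open>
  By the Stein equation the derivative equals \<open>x * f x\<close> plus a staircase and a constant. Expanding
  \<open>x * f x\<close> around \<open>v\<close> produces the factor \<open>\<bar>v\<bar>\<close>, since \<open>f\<close> is bounded by \<open>mills 0\<close> and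
  is 1-Lipschitz. The constant does not depend on the position \<open>z\<close> of the thresholds, which is what makes
  the final bound uniform.
\<close>

lemma smooth_stein'_lipschitz:
  "\<bar>smooth_stein' z \<eta> m (v + y) - smooth_stein' z \<eta> m v\<bar>
     \<le> (\<bar>v\<bar> + (mills 0 + 1 / (real m * \<eta>))) * \<bar>y\<bar> + 1 / real m"
proof -
  let ?F = "smooth_stein z \<eta> m" and ?A = "\<lambda>x. avg m (\<lambda>j. indicator {..z + real j * \<eta>} x)"
  have "smooth_stein' z \<eta> m (v + y) - smooth_stein' z \<eta> m v
      = (y * ?F (v + y) + v * (?F (v + y) - ?F v)) + (?A (v + y) - ?A v)"
    using smooth_stein_equation[of z \<eta> m "v + y"] smooth_stein_equation[of z \<eta> m v]
    by (simp add: algebra_simps)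
  moreover have "\<bar>y * ?F (v + y)\<bar> \<le> \<bar>y\<bar> * mills 0"
    unfolding abs_mult by (intro mult_left_mono smooth_stein_bound) simp
  moreover have "\<bar>v * (?F (v + y) - ?F v)\<bar> \<le> \<bar>v\<bar> * \<bar>y\<bar>"
    unfolding abs_mult using smooth_stein_lipschitz[of "v + y" v] by (intro mult_left_mono) auto
  moreover have "\<bar>?A (v + y) - ?A v\<bar> \<le> \<bar>y\<bar> / (real m * \<eta>) + 1 / real m"
    using avg_indicator_lipschitz[OF eta m, of z "v + y" v] by simp
  moreover have "(\<bar>v\<bar> + (mills 0 + 1 / (real m * \<eta>))) * \<bar>y\<bar> + 1 / real m
     = \<bar>y\<bar> * mills 0 + \<bar>v\<bar> * \<bar>y\<bar> + (\<bar>y\<bar> / (real m * \<eta>) + 1 / real m)"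
    by (simp add: algebra_simps)
  ultimately show ?thesis by linarith
qed

lemma smooth_stein_taylor1:
  "\<bar>smooth_stein z \<eta> m (v + y) - smooth_stein z \<eta> m v - y * smooth_stein' z \<eta> m v\<bar> \<le> \<bar>y\<bar>"
  using smooth_stein_increment[of v "v + y" "smooth_stein' z \<eta> m v" 1] smooth_stein'_osc by simp

lemma smooth_stein_taylor:
  "\<bar>smooth_stein z \<eta> m (v + y) - smooth_stein z \<eta> m v - y * smooth_stein' z \<eta> m v\<bar>
     \<le> \<bar>y\<bar> * ((\<bar>v\<bar> + (mills 0 + 1 / (real m * \<eta>))) * \<bar>y\<bar> + 1 / real m)"
proof -
  let ?C = "\<bar>v\<bar> + (mills 0 + 1 / (real m * \<eta>))"
  have C: "0 \<le> ?C" using mills_nonneg[of 0] eta by simp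
  have "\<bar>smooth_stein' z \<eta> m u - smooth_stein' z \<eta> m v\<bar> \<le> ?C * \<bar>y\<bar> + 1 / real m"
    if "u \<in> closed_segment v (v + y)" for u
  proof -
    have "\<bar>u - v\<bar> \<le> \<bar>y\<bar>" using that by (auto simp: closed_segment_eq_real_ivl split: if_splits)
    hence "?C * \<bar>u - v\<bar> \<le> ?C * \<bar>y\<bar>" using C by (rule mult_left_mono)
    thus ?thesis using smooth_stein'_lipschitz[of v "u - v"] by simp
  qed
  from smooth_stein_increment[of v "v + y", OF this] show ?thesis by simp
qed

end

section \<open>The Stein identity for sums of independent variables\<close>

lemma (in prob_space) expectation_abs_le_sqrt:
  fixes Y :: "'a \<Rightarrow> real"
  assumes "Y \<in> borel_measurable M" "integrable M (\<lambda>w. (Y w)\<^sup>2)"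
  shows "integrable M Y" "expectation (\<lambda>w. \<bar>Y w\<bar>) \<le> sqrt (expectation (\<lambda>w. (Y w)\<^sup>2))"
proof -
  show i: "integrable M Y" using square_integrable_imp_integrable[OF assms] .
  have "variance (\<lambda>w. \<bar>Y w\<bar>) = expectation (\<lambda>w. \<bar>Y w\<bar>\<^sup>2) - (expectation (\<lambda>w. \<bar>Y w\<bar>))\<^sup>2"
    using i assms by (intro variance_eq) auto
  hence "(expectation (\<lambda>w. \<bar>Y w\<bar>))\<^sup>2 \<le> expectation (\<lambda>w. (Y w)\<^sup>2)"
    using variance_positive[of "\<lambda>w. \<bar>Y w\<bar>"] by simp
  thus "expectation (\<lambda>w. \<bar>Y w\<bar>) \<le> sqrt (expectation (\<lambda>w. (Y w)\<^sup>2))" by (rule real_le_rsqrt)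
qed

text \<open>
  Bienayme's identity for centred variables.
\<close>

lemma (in prob_space) second_moment_sum:
  fixes X :: "'i \<Rightarrow> 'a \<Rightarrow> real"
  assumes "finite I" "indep_vars (\<lambda>_. borel) X I"
    and "\<And>i. i \<in> I \<Longrightarrow> integrable M (\<lambda>w. (X i w)\<^sup>2)" "\<And>i. i \<in> I \<Longrightarrow> expectation (X i) = 0"
  shows "integrable M (\<lambda>w. (\<Sum>i\<in>I. X i w)\<^sup>2) \<and>
     expectation (\<lambda>w. (\<Sum>i\<in>I. X i w)\<^sup>2) = (\<Sum>i\<in>I. expectation (\<lambda>w. (X i w)\<^sup>2))"
  using assms
proof (induction I rule: finite_induct)
  case (insert i I)
  let ?S = "\<lambda>w. \<Sum>i\<in>I. X i w"
  have iv: "indep_vars (\<lambda>_. borel) X I" using insert.prems(1) by (rule indep_vars_subset) auto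
  have rv: "X j \<in> borel_measurable M" if "j \<in> insert i I" for j
    using insert.prems(1) that by (auto simp: indep_vars_def)
  have IH: "integrable M (\<lambda>w. (?S w)\<^sup>2)"
    "expectation (\<lambda>w. (?S w)\<^sup>2) = (\<Sum>i\<in>I. expectation (\<lambda>w. (X i w)\<^sup>2))"
    using insert.IH[OF iv] insert.prems by auto
  have ind: "indep_var borel (X i) borel ?S"
    by (rule indep_vars_sum[OF insert.hyps insert.prems(1)])
  have Xi: "integrable M (X i)" using expectation_abs_le_sqrt(1)[OF rv insert.prems(2)] by simp
  have S: "integrable M ?S" by (rule expectation_abs_le_sqrt(1)[OF _ IH(1)]) (use rv in \<open>auto intro!: borel_measurable_sum\<close>)
  have eq: "(\<Sum>j\<in>insert i I. X j w)\<^sup>2 = (X i w)\<^sup>2 + 2 * (X i w * ?S w) + (?S w)\<^sup>2" for w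
    using insert.hyps by (simp add: power2_eq_square algebra_simps)
  have "expectation (\<lambda>w. X i w * ?S w) = 0"
    using indep_var_lebesgue_integral[OF ind Xi S] insert.prems(3) by simp
  moreover have xs: "integrable M (\<lambda>w. X i w * ?S w)" by (rule indep_var_integrable[OF ind Xi S])
  ultimately show ?case using insert.prems(2)[of i] IH insert.hyps
    unfolding eq by simp
qed simp

lemma (in prob_space) indep_expectation:
  fixes f g :: "real \<Rightarrow> real"
  assumes "indep_var borel U borel V" "f \<in> borel_measurable borel" "g \<in> borel_measurable borel"
    "integrable M (\<lambda>w. f (U w))" "integrable M (\<lambda>w. g (V w))"
  shows "integrable M (\<lambda>w. f (U w) * g (V w))"
    "expectation (\<lambda>w. f (U w) * g (V w)) = expectation (\<lambda>w. f (U w)) * expectation (\<lambda>w. g (V w))"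
proof -
  have "indep_var borel (\<lambda>w. f (U w)) borel (\<lambda>w. g (V w))"
    using indep_var_compose[OF assms(1-3)] by (simp add: comp_def)
  from indep_var_lebesgue_integral[OF this assms(4,5)] indep_var_integrable[OF this assms(4,5)]
  show "integrable M (\<lambda>w. f (U w) * g (V w))"
    "expectation (\<lambda>w. f (U w) * g (V w)) = expectation (\<lambda>w. f (U w)) * expectation (\<lambda>w. g (V w))" by auto
qed

text \<open>
  The contribution of one summand \<open>Y\<close> of \<open>W = V + Y\<close>. The remainder bound \<open>taylor1\<close> is used on
  \<open>\<bar>Y\<bar> \<ge> \<epsilon>\<close>, where it produces the truncated second moment with constant \<open>1\<close>, and \<open>taylor\<close> on
  \<open>\<bar>Y\<bar> < \<epsilon>\<close>. The weight \<open>\<bar>v\<bar>\<close> in \<open>taylor\<close> and \<open>lip\<close> is harmless, because \<open>V\<close> is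
  independent of \<open>Y\<close> and its first absolute moment is at most \<open>1\<close>.
\<close>

lemma (in prob_space) stein_summand_bound:
  fixes Y V :: "'a \<Rightarrow> real" and F D :: "real \<Rightarrow> real"
  assumes ind: "indep_var borel Y borel V"
    and Ysq: "integrable M (\<lambda>w. (Y w)\<^sup>2)" and Y0: "expectation Y = 0"
    and Vint: "integrable M V" and V1: "expectation (\<lambda>w. \<bar>V w\<bar>) \<le> 1"
    and F: "F \<in> borel_measurable borel" "\<And>x. \<bar>F x\<bar> \<le> B"
    and D: "D \<in> borel_measurable borel" "\<And>x. \<bar>D x\<bar> \<le> 1"
    and C: "0 \<le> C" and K: "0 \<le> \<kappa>" and e: "0 < \<epsilon>"
    and taylor1: "\<And>v y. \<bar>F (v + y) - F v - y * D v\<bar> \<le> \<bar>y\<bar>"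
    and taylor: "\<And>v y. \<bar>F (v + y) - F v - y * D v\<bar> \<le> \<bar>y\<bar> * ((\<bar>v\<bar> + C) * \<bar>y\<bar> + \<kappa>)"
    and lip: "\<And>v y. \<bar>D (v + y) - D v\<bar> \<le> (\<bar>v\<bar> + C) * \<bar>y\<bar> + \<kappa>"
  shows "\<bar>expectation (\<lambda>w. Y w * F (V w + Y w)) -
           expectation (\<lambda>w. (Y w)\<^sup>2) * expectation (\<lambda>w. D (V w + Y w))\<bar>
    \<le> (LINT w:{w \<in> space M. \<bar>Y w\<bar> \<ge> \<epsilon>}|M. (Y w)\<^sup>2)
      + expectation (\<lambda>w. (Y w)\<^sup>2) * ((1 + C) * (\<epsilon> + sqrt (expectation (\<lambda>w. (Y w)\<^sup>2))) + 2 * \<kappa>)"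
proof -
  note [measurable] = F(1) D(1)
  have [measurable]: "Y \<in> borel_measurable M" "V \<in> borel_measurable M"
    using indep_var_rv1[OF ind] indep_var_rv2[OF ind] by auto
  define s2 where "s2 = expectation (\<lambda>w. (Y w)\<^sup>2)"
  have s2: "0 \<le> s2" by (simp add: s2_def)
  have Yint: "integrable M Y" and Yabs: "expectation (\<lambda>w. \<bar>Y w\<bar>) \<le> sqrt s2"
    using expectation_abs_le_sqrt[of Y] Ysq by (auto simp: s2_def)
  define R where "R w = F (V w + Y w) - F (V w) - Y w * D (V w)" for w
  have [measurable]: "R \<in> borel_measurable M" unfolding R_def[abs_def] by measurable
  have Fint: "integrable M (\<lambda>w. F (V w))" by (rule integrable_const_bound[of _ B]) (auto simp: F)
  have Dint: "integrable M (\<lambda>w. D (V w))" by (rule integrable_const_bound[of _ 1]) (auto simp: D)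
  have DWint: "integrable M (\<lambda>w. D (V w + Y w))" by (rule integrable_const_bound[of _ 1]) (auto simp: D)
  note YF = indep_expectation[OF ind, of "\<lambda>y. y" F, OF _ F(1) Yint Fint, simplified Y0, simplified]
  note YD = indep_expectation[OF ind, of "\<lambda>y. y\<^sup>2" D, OF _ D(1) Ysq Dint, simplified]
  have YRint: "integrable M (\<lambda>w. Y w * R w)"
  proof (rule Bochner_Integration.integrable_bound[OF Ysq])
    show "AE w in M. norm (Y w * R w) \<le> norm ((Y w)\<^sup>2)"
    proof (rule AE_I2)
      fix w
      have "\<bar>Y w\<bar> * \<bar>R w\<bar> \<le> \<bar>Y w\<bar> * \<bar>Y w\<bar>" unfolding R_def by (intro mult_left_mono taylor1) auto
      thus "norm (Y w * R w) \<le> norm ((Y w)\<^sup>2)" by (simp add: abs_mult power2_eq_square)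
    qed
  qed measurable
  have split: "Y w * F (V w + Y w) = Y w * F (V w) + (Y w)\<^sup>2 * D (V w) + Y w * R w" for w
    by (simp add: R_def algebra_simps power2_eq_square)
  have "expectation (\<lambda>w. Y w * F (V w + Y w))
     = s2 * expectation (\<lambda>w. D (V w)) + expectation (\<lambda>w. Y w * R w)"
    unfolding split using YF YD YRint by (simp add: s2_def)
  hence eq: "expectation (\<lambda>w. Y w * F (V w + Y w)) - s2 * expectation (\<lambda>w. D (V w + Y w))
     = expectation (\<lambda>w. Y w * R w) - s2 * expectation (\<lambda>w. D (V w + Y w) - D (V w))"
    using Dint DWint by (simp add: algebra_simps)
  \<comment> \<open>The remaining error has two parts. First, \<open>E (D V)\<close> is replaced by \<open>E (D W)\<close>.\<close>
  have aint: "integrable M (\<lambda>w. \<bar>V w\<bar> + C)" using Vint by simp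
  have aexp: "expectation (\<lambda>w. \<bar>V w\<bar> + C) \<le> 1 + C" using Vint V1 by (simp add: prob_space)
  note YV = indep_expectation[OF ind, of "\<lambda>y. \<bar>y\<bar>" "\<lambda>v. \<bar>v\<bar> + C", OF _ _ _ aint, simplified]
  note YYV = indep_expectation[OF ind, of "\<lambda>y. y\<^sup>2" "\<lambda>v. \<bar>v\<bar> + C", OF _ _ Ysq aint, simplified]
  have "\<bar>expectation (\<lambda>w. D (V w + Y w) - D (V w))\<bar>
      \<le> expectation (\<lambda>w. \<bar>Y w\<bar> * (\<bar>V w\<bar> + C) + \<kappa>)"
    using YV(1) Yint Dint DWint lip
    by (intro order_trans[OF integral_abs_bound] integral_mono) (auto simp: mult.commute)
  also have "\<dots> = expectation (\<lambda>w. \<bar>Y w\<bar>) * expectation (\<lambda>w. \<bar>V w\<bar> + C) + \<kappa>"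
    using YV Yint by (simp add: prob_space)
  also have "\<dots> \<le> sqrt s2 * (1 + C) + \<kappa>"
    using Yabs aexp C s2 by (intro add_right_mono mult_mono) auto
  finally have second: "\<bar>s2 * expectation (\<lambda>w. D (V w + Y w) - D (V w))\<bar> \<le> s2 * (sqrt s2 * (1 + C) + \<kappa>)"
    using s2 by (simp add: abs_mult mult_left_mono)
  \<comment> \<open>Second, the Taylor remainder, split according to the size of \<open>Y\<close>.\<close>
  have bd: "\<bar>Y w * R w\<bar> \<le> indicator {w \<in> space M. \<bar>Y w\<bar> \<ge> \<epsilon>} w * (Y w)\<^sup>2 + (\<epsilon> * ((Y w)\<^sup>2 * (\<bar>V w\<bar> + C)) + \<kappa> * (Y w)\<^sup>2)"
    if "w \<in> space M" for w
  proof (cases "\<bar>Y w\<bar> \<ge> \<epsilon>")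
    case True
    have "\<bar>Y w * R w\<bar> \<le> \<bar>Y w\<bar> * \<bar>Y w\<bar>"
      unfolding abs_mult R_def by (intro mult_left_mono taylor1) auto
    moreover have "0 \<le> \<epsilon> * ((Y w)\<^sup>2 * (\<bar>V w\<bar> + C)) + \<kappa> * (Y w)\<^sup>2" using C K e by simp
    ultimately show ?thesis using True that by (simp add: power2_eq_square)
  next
    case False
    have "\<bar>Y w * R w\<bar> \<le> \<bar>Y w\<bar> * (\<bar>Y w\<bar> * ((\<bar>V w\<bar> + C) * \<bar>Y w\<bar> + \<kappa>))"
      unfolding abs_mult R_def by (intro mult_left_mono taylor) auto
    also have "\<dots> \<le> \<bar>Y w\<bar> * (\<bar>Y w\<bar> * ((\<bar>V w\<bar> + C) * \<epsilon> + \<kappa>))"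
      using False C by (intro mult_left_mono add_right_mono) auto
    also have "\<dots> = \<epsilon> * ((Y w)\<^sup>2 * (\<bar>V w\<bar> + C)) + \<kappa> * (Y w)\<^sup>2"
      by (simp add: algebra_simps power2_eq_square)
    finally show ?thesis using False by simp
  qed
  have Lint: "integrable M (\<lambda>w. indicator {w \<in> space M. \<bar>Y w\<bar> \<ge> \<epsilon>} w * (Y w)\<^sup>2)"
    using integrable_mult_indicator[of "{w \<in> space M. \<bar>Y w\<bar> \<ge> \<epsilon>}" M, OF _ Ysq] by simp
  have "\<bar>expectation (\<lambda>w. Y w * R w)\<bar> \<le> expectation (\<lambda>w. indicator {w \<in> space M. \<bar>Y w\<bar> \<ge> \<epsilon>} w * (Y w)\<^sup>2 + (\<epsilon> * ((Y w)\<^sup>2 * (\<bar>V w\<bar> + C)) + \<kappa> * (Y w)\<^sup>2))"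
    using YRint Lint YYV(1) Ysq bd
    by (intro order_trans[OF integral_abs_bound] integral_mono Bochner_Integration.integrable_add integrable_abs integrable_mult_right) auto
  also have "\<dots> = expectation (\<lambda>w. indicator {w \<in> space M. \<bar>Y w\<bar> \<ge> \<epsilon>} w * (Y w)\<^sup>2) +
      (\<epsilon> * (s2 * expectation (\<lambda>w. \<bar>V w\<bar> + C)) + \<kappa> * s2)"
    using Lint YYV Ysq by (simp add: s2_def del: Bochner_Integration.integral_indicator)
  also have "\<dots> \<le> expectation (\<lambda>w. indicator {w \<in> space M. \<bar>Y w\<bar> \<ge> \<epsilon>} w * (Y w)\<^sup>2) + (\<epsilon> * (s2 * (1 + C)) + \<kappa> * s2)"
    using aexp e s2 by (intro add_left_mono add_right_mono mult_left_mono) auto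
  finally have first: "\<bar>expectation (\<lambda>w. Y w * R w)\<bar> \<le> (LINT w:{w \<in> space M. \<bar>Y w\<bar> \<ge> \<epsilon>}|M. (Y w)\<^sup>2) + (\<epsilon> * (s2 * (1 + C)) + \<kappa> * s2)"
    by (simp add: set_lebesgue_integral_def)
  have alg: "\<epsilon> * (s2 * (1 + C)) + \<kappa> * s2 + s2 * (sqrt s2 * (1 + C) + \<kappa>) = s2 * ((1 + C) * (\<epsilon> + sqrt s2) + 2 * \<kappa>)"
    by (simp add: algebra_simps)
  show ?thesis unfolding s2_def[symmetric] eq using first second alg by linarith
qed

text \<open>
  Summing \<open>stein_summand_bound\<close> over all choices of the distinguished summand: the variances have
  total \<open>1\<close>, so the error terms appear as a convex combination.
\<close>

lemma (in prob_space) stein_identity_bound: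
  fixes X :: "'i \<Rightarrow> 'a \<Rightarrow> real" and F D :: "real \<Rightarrow> real"
  assumes fin: "finite I" and ind: "indep_vars (\<lambda>_. borel) X I"
    and sq: "\<And>i. i \<in> I \<Longrightarrow> integrable M (\<lambda>w. (X i w)\<^sup>2)"
    and mean: "\<And>i. i \<in> I \<Longrightarrow> expectation (X i) = 0"
    and var: "(\<Sum>i\<in>I. expectation (\<lambda>w. (X i w)\<^sup>2)) = 1"
    and small: "\<And>i. i \<in> I \<Longrightarrow> expectation (\<lambda>w. (X i w)\<^sup>2) \<le> \<tau>"
    and F: "F \<in> borel_measurable borel" "\<And>x. \<bar>F x\<bar> \<le> B"
    and D: "D \<in> borel_measurable borel" "\<And>x. \<bar>D x\<bar> \<le> 1"
    and C: "0 \<le> C" and K: "0 \<le> \<kappa>" and e: "0 < \<epsilon>"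
    and taylor1: "\<And>v y. \<bar>F (v + y) - F v - y * D v\<bar> \<le> \<bar>y\<bar>"
    and taylor: "\<And>v y. \<bar>F (v + y) - F v - y * D v\<bar> \<le> \<bar>y\<bar> * ((\<bar>v\<bar> + C) * \<bar>y\<bar> + \<kappa>)"
    and lip: "\<And>v y. \<bar>D (v + y) - D v\<bar> \<le> (\<bar>v\<bar> + C) * \<bar>y\<bar> + \<kappa>"
  defines "W \<equiv> \<lambda>w. \<Sum>i\<in>I. X i w"
  shows "integrable M (\<lambda>w. W w * F (W w))"
    and "\<bar>expectation (\<lambda>w. W w * F (W w)) - expectation (\<lambda>w. D (W w))\<bar>
      \<le> (\<Sum>i\<in>I. LINT w:{w \<in> space M. \<bar>X i w\<bar> \<ge> \<epsilon>}|M. (X i w)\<^sup>2) + ((1 + C) * (\<epsilon> + sqrt \<tau>) + 2 * \<kappa>)"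
proof -
  note [measurable] = F(1) D(1)
  have rv[measurable]: "X i \<in> borel_measurable M" if "i \<in> I" for i
    using ind that by (auto simp: indep_vars_def)
  have [measurable]: "W \<in> borel_measurable M" unfolding W_def by (rule borel_measurable_sum) (rule rv)
  have int: "integrable M (X i)" if "i \<in> I" for i
    using expectation_abs_le_sqrt(1)[OF rv sq] that by auto
  have XF: "integrable M (\<lambda>w. X i w * F (W w))" if "i \<in> I" for i
  proof (rule Bochner_Integration.integrable_bound)
    show "integrable M (\<lambda>w. B * X i w)" using int[OF that] by simp
    show "(\<lambda>w. X i w * F (W w)) \<in> borel_measurable M" using rv[OF that] by measurable
    have "\<bar>X i w\<bar> * \<bar>F (W w)\<bar> \<le> \<bar>X i w\<bar> * \<bar>B\<bar>" for w
      using F(2)[of "W w"] by (intro mult_left_mono) auto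
    thus "AE w in M. norm (X i w * F (W w)) \<le> norm (B * X i w)"
      by (auto simp: abs_mult mult.commute)
  qed
  have sumeq: "W w * F (W w) = (\<Sum>i\<in>I. X i w * F (W w))" for w
    by (simp add: W_def sum_distrib_right)
  show "integrable M (\<lambda>w. W w * F (W w))" unfolding sumeq using XF by simp
  let ?v = "\<lambda>i. expectation (\<lambda>w. (X i w)\<^sup>2)"
  let ?L = "\<lambda>i. LINT w:{w \<in> space M. \<bar>X i w\<bar> \<ge> \<epsilon>}|M. (X i w)\<^sup>2"
  let ?b = "(1 + C) * (\<epsilon> + sqrt \<tau>) + 2 * \<kappa>"
  have summand: "\<bar>expectation (\<lambda>w. X i w * F (W w)) - ?v i * expectation (\<lambda>w. D (W w))\<bar> \<le> ?L i + ?v i * ?b"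
    if i: "i \<in> I" for i
  proof -
    define V where "V w = (\<Sum>j\<in>I - {i}. X j w)" for w
    have WV: "W w = V w + X i w" for w
      using fin i by (simp add: W_def V_def sum.remove[of I i])
    have iXV: "indep_var borel (X i) borel V"
      unfolding V_def[abs_def] by (rule indep_vars_sum) (use fin i ind in \<open>auto simp: insert_absorb\<close>)
    have V2: "integrable M (\<lambda>w. (V w)\<^sup>2) \<and> expectation (\<lambda>w. (V w)\<^sup>2) = (\<Sum>j\<in>I - {i}. ?v j)"
      unfolding V_def using fin sq mean by (intro second_moment_sum indep_vars_subset[OF ind]) auto
    have "(\<Sum>j\<in>I - {i}. ?v j) \<le> 1" using fin var by (auto intro: order_trans[OF sum_mono2[of I "I - {i}"]])
    hence "sqrt (expectation (\<lambda>w. (V w)\<^sup>2)) \<le> 1" using V2 by simp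
    have V: "V \<in> borel_measurable M" unfolding V_def[abs_def] by (rule borel_measurable_sum) (use rv in auto)
    have V1: "integrable M V" "expectation (\<lambda>w. \<bar>V w\<bar>) \<le> 1"
      using expectation_abs_le_sqrt[OF V V2[THEN conjunct1]]
        \<open>sqrt (expectation (\<lambda>w. (V w)\<^sup>2)) \<le> 1\<close> by linarith+
    have "\<bar>expectation (\<lambda>w. X i w * F (V w + X i w)) - ?v i * expectation (\<lambda>w. D (V w + X i w))\<bar>
       \<le> ?L i + ?v i * ((1 + C) * (\<epsilon> + sqrt (?v i)) + 2 * \<kappa>)"
      by (rule stein_summand_bound[OF iXV sq[OF i] mean[OF i] V1 F D C K e taylor1 taylor lip])
    also have "\<dots> \<le> ?L i + ?v i * ?b"
      using small[OF i] C by (intro add_left_mono mult_left_mono add_right_mono) auto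
    finally show ?thesis by (simp add: WV)
  qed
  have "expectation (\<lambda>w. W w * F (W w)) - expectation (\<lambda>w. D (W w))
     = (\<Sum>i\<in>I. expectation (\<lambda>w. X i w * F (W w))) - (\<Sum>i\<in>I. ?v i) * expectation (\<lambda>w. D (W w))"
    unfolding sumeq var using XF by simp
  also have "\<dots> = (\<Sum>i\<in>I. expectation (\<lambda>w. X i w * F (W w)) - ?v i * expectation (\<lambda>w. D (W w)))"
    by (simp add: sum_subtractf sum_distrib_right)
  finally have "\<bar>expectation (\<lambda>w. W w * F (W w)) - expectation (\<lambda>w. D (W w))\<bar> \<le> (\<Sum>i\<in>I. ?L i + ?v i * ?b)"
    using summand by (simp add: order_trans[OF sum_abs sum_mono])
  also have "\<dots> = (\<Sum>i\<in>I. ?L i) + ?b"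
    by (simp only: sum.distrib sum_distrib_right[symmetric] var mult_1)
  finally show "\<bar>expectation (\<lambda>w. W w * F (W w)) - expectation (\<lambda>w. D (W w))\<bar> \<le> (\<Sum>i\<in>I. ?L i) + ?b" .
qed

section \<open>The Kolmogorov distance\<close>

lemma Phi_lipschitz: assumes "x \<le> y" shows "Phi y - Phi x \<le> y - x"
proof -
  have "(\<lambda>t. t - Phi t) x \<le> (\<lambda>t. t - Phi t) y"
  proof (rule DERIV_nonneg_imp_nondecreasing[OF assms])
    fix t show "\<exists>d. ((\<lambda>t. t - Phi t) has_real_derivative d) (at t) \<and> 0 \<le> d"
      using DERIV_diff[OF DERIV_ident Phi_deriv[of t]] phi_le_1[of t] by fastforce
  qed
  thus ?thesis by simp
qed

text \<open>
  The thresholds are spread over \<open>{x..x + \<delta>}\<close> for the upper estimate of the distribution function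
  of the sum at \<open>x\<close> and over \<open>{x - \<delta>..x}\<close> for the lower one. The number of thresholds enters
  through an additional error \<open>2 / m\<close> only, which disappears in the limit.
\<close>

lemma (in prob_space) kolmogorov_stein_bound:
  fixes X :: "'i \<Rightarrow> 'a \<Rightarrow> real"
  assumes fin: "finite I" and ind: "indep_vars (\<lambda>_. borel) X I"
    and sq: "\<And>i. i \<in> I \<Longrightarrow> integrable M (\<lambda>w. (X i w)\<^sup>2)"
    and mean: "\<And>i. i \<in> I \<Longrightarrow> expectation (X i) = 0"
    and var: "(\<Sum>i\<in>I. expectation (\<lambda>w. (X i w)\<^sup>2)) = 1"
    and small: "\<And>i. i \<in> I \<Longrightarrow> expectation (\<lambda>w. (X i w)\<^sup>2) \<le> \<tau>"
    and e: "0 < \<epsilon>" and d: "0 < \<delta>"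
  shows "\<bar>Phi x - prob {w \<in> space M. (\<Sum>i\<in>I. X i w) \<le> x}\<bar>
     \<le> (\<Sum>i\<in>I. LINT w:{w \<in> space M. \<bar>X i w\<bar> \<ge> \<epsilon>}|M. (X i w)\<^sup>2)
       + (1 + (mills 0 + 1 / \<delta>)) * (\<epsilon> + sqrt \<tau>) + \<delta>"
proof -
  define W where "W w = (\<Sum>i\<in>I. X i w)" for w
  define Q where "Q s = prob {w \<in> space M. W w \<le> s}" for s
  define E where "E = (\<Sum>i\<in>I. LINT w:{w \<in> space M. \<bar>X i w\<bar> \<ge> \<epsilon>}|M. (X i w)\<^sup>2)
       + (1 + (mills 0 + 1 / \<delta>)) * (\<epsilon> + sqrt \<tau>)"
  have rv: "X i \<in> borel_measurable M" if "i \<in> I" for i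
    using ind that by (auto simp: indep_vars_def)
  have [measurable]: "W \<in> borel_measurable M" unfolding W_def[abs_def] by (rule borel_measurable_sum) (rule rv)
  have Qmono: "Q s \<le> Q t" if "s \<le> t" for s t
    unfolding Q_def by (rule finite_measure_mono) (use that in auto)
  \<comment> \<open>The bound for averages over thresholds, from the Stein identity for the averaged solution.\<close>
  have smoothed: "\<bar>avg m (\<lambda>j. Q (z + real j * (\<delta> / real m)) - Phi (z + real j * (\<delta> / real m)))\<bar> \<le> E + 2 / real m"
    if m: "0 < m" for m z
  proof -
    define \<eta> where "\<eta> = \<delta> / real m"
    have eta: "0 < \<eta>" and me: "real m * \<eta> = \<delta>" using m d by (simp_all add: \<eta>_def)
    let ?F = "smooth_stein z \<eta> m" and ?D = "smooth_stein' z \<eta> m"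
    have C: "0 \<le> mills 0 + 1 / \<delta>" using mills_nonneg[of 0] d by simp
    note bound = stein_identity_bound[OF fin ind sq mean var small smooth_stein_measurable
        smooth_stein_bound[OF eta m] smooth_stein'_measurable smooth_stein'_bound[OF eta m]
        C _ e smooth_stein_taylor1[OF eta m] smooth_stein_taylor[OF eta m, unfolded me]
        smooth_stein'_lipschitz[OF eta m, unfolded me], folded W_def]
    have Dint: "integrable M (\<lambda>w. ?D (W w))"
      by (rule integrable_const_bound[of _ 1])
        (use smooth_stein'_measurable[measurable] smooth_stein'_bound[OF eta m] in auto)
    have "?D (W w) - W w * ?F (W w) = avg m (\<lambda>j. indicator {w \<in> space M. W w \<le> z + real j * \<eta>} w)
        - avg m (\<lambda>j. Phi (z + real j * \<eta>))" if "w \<in> space M" for w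
      unfolding smooth_stein_equation using that by (simp add: indicator_def)
    hence "expectation (\<lambda>w. ?D (W w) - W w * ?F (W w))
       = expectation (\<lambda>w. avg m (\<lambda>j. indicator {w \<in> space M. W w \<le> z + real j * \<eta>} w)
        - avg m (\<lambda>j. Phi (z + real j * \<eta>)))"
      by (intro Bochner_Integration.integral_cong) auto
    also have "\<dots> = avg m (\<lambda>j. Q (z + real j * \<eta>)) - avg m (\<lambda>j. Phi (z + real j * \<eta>))"
    proof -
      have I: "integrable M (indicat_real {w \<in> space M. W w \<le> t})" for t
        by (rule integrable_real_indicator) (auto simp: less_top[symmetric])
      show ?thesis unfolding avg_def Q_def
        by (subst Bochner_Integration.integral_diff)
           (auto simp: prob_space I Bochner_Integration.integral_sum)
    qed
    finally have "expectation (\<lambda>w. ?D (W w)) - expectation (\<lambda>w. W w * ?F (W w))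
       = avg m (\<lambda>j. Q (z + real j * \<eta>) - Phi (z + real j * \<eta>))"
      using Dint bound(1) by (simp add: avg_diff)
    moreover have "\<bar>expectation (\<lambda>w. W w * ?F (W w)) - expectation (\<lambda>w. ?D (W w))\<bar> \<le> E + 2 / real m"
      using bound(2) by (simp add: E_def add.assoc)
    ultimately show ?thesis unfolding \<eta>_def[symmetric] by linarith
  qed
  have step: "real j * (\<delta> / real m) \<le> \<delta>" if "j < m" for j m
    using that d by (simp add: field_simps)
  have "\<bar>Phi x - Q x\<bar> \<le> E + \<delta> + 2 / real (Suc n)" for n
  proof -
    let ?m = "Suc n"
    let ?s = "\<lambda>z j. z + real j * (\<delta> / real ?m)"
    have s: "z \<le> ?s z j" "?s z j \<le> z + \<delta>" if "j < ?m" for z j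
      using step[OF that] d by auto
    have "Q x - Phi x - \<delta> = avg ?m (\<lambda>_. Q x - Phi x - \<delta>)" by (simp only: avg_const zero_less_Suc)
    also have "\<dots> \<le> avg ?m (\<lambda>j. Q (?s x j) - Phi (?s x j))"
    proof (rule avg_mono)
      fix j assume j: "j < ?m"
      show "Q x - Phi x - \<delta> \<le> Q (?s x j) - Phi (?s x j)"
        using Qmono[OF s(1)[OF j, of x]] Phi_lipschitz[OF s(1)[OF j, of x]] s(2)[OF j, of x] by linarith
    qed
    also have "\<dots> \<le> E + 2 / real ?m" using smoothed[of ?m x] by linarith
    finally have up: "Q x - Phi x - \<delta> \<le> E + 2 / real ?m" .
    let ?z = "x - \<delta>"
    have "avg ?m (\<lambda>j. Q (?s ?z j) - Phi (?s ?z j)) \<le> avg ?m (\<lambda>_. Q x - Phi x + \<delta>)"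
    proof (rule avg_mono)
      fix j assume j: "j < ?m"
      have sx: "?s ?z j \<le> x" using s(2)[OF j, of ?z] by linarith
      show "Q (?s ?z j) - Phi (?s ?z j) \<le> Q x - Phi x + \<delta>"
        using Qmono[OF sx] Phi_lipschitz[OF sx] s(1)[OF j, of ?z] by linarith
    qed
    also have "\<dots> = Q x - Phi x + \<delta>" by (simp only: avg_const zero_less_Suc)
    finally have "- (E + 2 / real ?m) \<le> Q x - Phi x + \<delta>" using smoothed[of ?m ?z] by linarith
    with up show ?thesis by linarith
  qed
  moreover have "(\<lambda>n. E + \<delta> + 2 / real (Suc n)) \<longlonglongrightarrow> E + \<delta>" by real_asymp
  ultimately have "\<bar>Phi x - Q x\<bar> \<le> E + \<delta>" by (intro LIMSEQ_le_const) auto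
  thus ?thesis by (simp add: Q_def W_def E_def)
qed

lemma distributed_std_normal_cdf:
  assumes "distributed N lborel \<xi> std_normal_density"
  shows "measure N {w \<in> space N. \<xi> w \<le> x} = Phi x"
proof -
  have meas: "\<xi> \<in> measurable N lborel" using assms by (auto simp: distributed_def)
  have "Phi x = measure (distr N lborel \<xi>) {..x}"
    using assms by (simp add: Phi_def cdf_def2 distributed_def)
  also have "\<dots> = measure N (\<xi> -` {..x} \<inter> space N)"
    by (rule measure_distr[OF meas]) simp
  also have "\<xi> -` {..x} \<inter> space N = {w \<in> space N. \<xi> w \<le> x}" by auto
  finally show ?thesis by simp
qed

theorem theorem2p7:
  fixes M :: "nat \<Rightarrow> 'a measure" and X :: "nat \<Rightarrow> nat \<Rightarrow> 'a \<Rightarrow> real"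
    and N :: "'b measure" and \<xi> :: "'b \<Rightarrow> real"
  assumes "standard_triangular_array M X"
    and "feller_negligible M X"
    and "prob_space N"
    and "distributed N lborel \<xi> std_normal_density"
  shows "limsup (\<lambda>n. ereal (kolmogorov_dist N \<xi> (M n) (\<lambda>w. \<Sum>k=1..n. X n k w)))
           \<le> lindeberg_index M X"
proof (rule ereal_le_epsilon2)
  fix e :: real assume e: "0 < e"
  let ?K = "\<lambda>n. kolmogorov_dist N \<xi> (M n) (\<lambda>w. \<Sum>k=1..n. X n k w)"
  define \<tau> where "\<tau> n = Max (entry_var M X n ` {1..n})" for n
  \<comment> \<open>With \<open>\<epsilon> = \<delta>\<^sup>2\<close> the row error without the Lindeberg sum tends to
     \<open>\<delta> * (\<delta> * (1 + mills 0) + 2)\<close>, which is at most \<open>\<delta> * c\<close> as long as \<open>\<delta> \<le> 1\<close>.\<close>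
  define c where "c = 3 + mills 0"
  have c: "c \<ge> 3" using mills_nonneg[of 0] by (simp add: c_def)
  define \<delta> where "\<delta> = min 1 (e / c)"
  have d: "0 < \<delta>" "\<delta> \<le> 1" and dc: "\<delta> * c \<le> e"
    using e c by (auto simp: \<delta>_def min_def field_simps)
  define \<epsilon> where "\<epsilon> = \<delta>\<^sup>2"
  have eps: "0 < \<epsilon>" using d by (simp add: \<epsilon>_def)
  let ?S = "\<lambda>n. \<Sum>k=1..n. LINT w:{w \<in> space (M n). \<bar>X n k w\<bar> \<ge> \<epsilon>}|M n. (X n k w)\<^sup>2"
  define r where "r n = (1 + (mills 0 + 1 / \<delta>)) * (\<epsilon> + sqrt (\<tau> n)) + \<delta>" for n
  have row: "?K n \<le> r n + ?S n" if n: "n \<ge> 1" for n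
  proof -
    note sta = assms(1)[unfolded standard_triangular_array_def, rule_format, OF n]
    interpret prob_space "M n" using sta by blast
    show ?thesis
      unfolding kolmogorov_dist_def
    proof (rule cSUP_least)
      fix x :: real
      have "\<bar>Phi x - prob {w \<in> space (M n). (\<Sum>k=1..n. X n k w) \<le> x}\<bar>
          \<le> ?S n + (1 + (mills 0 + 1 / \<delta>)) * (\<epsilon> + sqrt (\<tau> n)) + \<delta>"
        by (rule kolmogorov_stein_bound)
          (use sta eps d in \<open>auto simp: \<tau>_def entry_var_def intro!: Max_ge\<close>)
      thus "\<bar>measure N {w \<in> space N. \<xi> w \<le> x} - prob {w \<in> space (M n). (\<Sum>k=1..n. X n k w) \<le> x}\<bar>
          \<le> r n + ?S n"
        unfolding distributed_std_normal_cdf[OF assms(4)] by (simp add: r_def)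
    qed simp
  qed
  have "\<tau> \<longlonglongrightarrow> 0" using assms(2) by (simp add: feller_negligible_def \<tau>_def[abs_def])
  hence "r \<longlonglongrightarrow> (1 + (mills 0 + 1 / \<delta>)) * (\<epsilon> + sqrt 0) + \<delta>"
    unfolding r_def[abs_def] by (intro tendsto_intros)
  moreover have "(1 + (mills 0 + 1 / \<delta>)) * (\<epsilon> + sqrt 0) + \<delta> = \<delta> * (\<delta> * (1 + mills 0) + 2)"
    using d by (simp add: \<epsilon>_def field_simps power2_eq_square)
  ultimately have r: "r \<longlonglongrightarrow> \<delta> * (\<delta> * (1 + mills 0) + 2)" by simp
  have "\<delta> * (1 + mills 0) \<le> 1 + mills 0"
    using d mills_nonneg[of 0] mult_right_mono[of \<delta> 1 "1 + mills 0"] by simp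
  hence "\<delta> * (\<delta> * (1 + mills 0) + 2) \<le> \<delta> * c"
    using d by (intro mult_left_mono) (auto simp: c_def)
  hence lim_le: "\<delta> * (\<delta> * (1 + mills 0) + 2) \<le> e" using dc by linarith
  have "limsup (\<lambda>n. ereal (?K n)) \<le> limsup (\<lambda>n. ereal (r n) + ereal (?S n))"
    by (rule Limsup_mono) (use row in \<open>auto intro!: eventually_sequentiallyI[of 1]\<close>)
  also have "\<dots> = ereal (\<delta> * (\<delta> * (1 + mills 0) + 2)) + limsup (\<lambda>n. ereal (?S n))"
    by (rule ereal_limsup_lim_add) (use r in auto)
  also have "\<dots> \<le> ereal e + lindeberg_index M X"
    unfolding lindeberg_index_def
    using lim_le eps by (intro add_mono SUP_upper2[of \<epsilon>]) auto
  finally show "limsup (\<lambda>n. ereal (?K n)) \<le> lindeberg_index M X + ereal e"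
    by (simp add: add.commute)
qed

end
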